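(* Assume that $\emptyset\neq G\subset\mathbb{R}^n$ is an open set, $0\le s\le 2$, and $1<p<\infty$. Let $\omega$ be an $A_p$ weight in $\mathbb{R}^n$ and let $R:G\to\mathbb{R}$ be a measurable function such that $0\le R(x)\le\operatorname{dist}(x,\partial G)$ for every $x\in G$. Then there exists a constant $C=C(n)>0$, depending only on $n$, such that for every $f\in L^p(G)$ satisfying $\omega_0\,S(f)\in L^p(\mathbb{R}^{2n})$ and $\omega_1\,S(f)\in L^p(\mathbb{R}^{2n})$, the inequality $$\omega(x-y)^{1/p}\,S_R(M_R(f))(x,y)\le C\sum_{\substack{i,j,k,l,m\in\{0,1\}\\ kl=0}}\Big(M_{ij}\big(\omega_m M_{kl}(S(f))\big)(x,y)+M_{ij}\big(\omega_m M_{kl}(S(f))\big)(y,x)\Big)$$ holds for almost every $(x,y)\in\mathbb{R}^{2n}$.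
   Context: Convention: $\operatorname{dist}(x,\partial G)=\infty$ if $x\in G=\mathbb{R}^n$. $B(x,r)$ is the open ball of center $x$ and radius $r$. For $f\in L^1_{\mathrm{loc}}(G)$ and $x\in G$, $$M_R(f)(x)=\sup_{0\le r\le R(x)}\frac{1}{|B(x,r)|}\int_{B(x,r)}|f(y)|\,dy,$$ where for $r=0$ the average is by convention equal to $|f(x)|$. A weight in $\mathbb{R}^n$ is a function $\omega\in L^1_{\mathrm{loc}}(\mathbb{R}^n)$ with $\omega>0$ almost everywhere. For $1<p<\infty$, it is an $A_p$ weight if there is $A>0$ such that $\big(\frac1{|Q|}\int_Q\omega\,dx\big)\big(\frac1{|Q|}\int_Q\omega^{-1/(p-1)}\,dx\big)^{p-1}\le A$ for every cube $Q\subset\mathbb{R}^n$. Notation: $\omega_0(x,y)=\omega(x-y)^{1/p}$ and $\omega_1(x,y)=\omega(y-x)^{1/p}$ for $x,y\in\mathbb{R}^n$. For $g\in L^p(G)$ and almost every $(x,y)\in\mathbb{R}^{2n}$, $$S_R(g)(x,y)=\frac{\chi_G(x)\chi_G(y)\,|g(x)-g(y)|}{(|x-y|+|R(x)-R(y)|)^{s}},$$ where the right-hand side is understood as $0$ if $x\notin G$ or $y\notin G$; and $S(g)$ denotes $S_R(g)$ with $R$ replaced by the zero function, i.e. $S(g)(x,y)=\chi_G(x)\chi_G(y)|g(x)-g(y)|/|x-y|^s$. For $i,j\in\{0,1\}$ and a measurable function $F$ on $\mathbb{R}^{2n}=\mathbb{R}^n\times\mathbb{R}^n$, $$M_{ij}(F)(x,y)=\sup_{r>0}\frac{1}{|B(0,r)|}\int_{B(0,r)}|F(x+iz,y+jz)|\,dz$$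 whenever the right-hand side is well-defined, which is the case for almost every $(x,y)$. In particular $M_{00}(F)=|F|$. *)

theory Defs
  imports "HOL-Analysis.Analysis"
begin

(* Functions on a set G are total HOL functions whose values outside G are never used.
   Measurability is Lebesgue measurability throughout. *)

definition Lp_space :: "real \<Rightarrow> 'a::euclidean_space set \<Rightarrow> ('a \<Rightarrow> real) set" where
  "Lp_space p G = {f \<in> borel_measurable (lebesgue_on G).
     integrable (lebesgue_on G) (\<lambda>x. \<bar>f x\<bar> powr p)}"

definition bdry_dist :: "'a::euclidean_space set \<Rightarrow> 'a \<Rightarrow> ereal" where
  "bdry_dist G x = (if G = UNIV then \<infinity> else ereal (infdist x (frontier G)))"

definition weight :: "('a::euclidean_space \<Rightarrow> real) \<Rightarrow> bool" where
  "weight \<omega> \<longleftrightarrow> \<omega> \<in> borel_measurable lebesgue \<and>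
     (\<forall>K. compact K \<longrightarrow> integrable (lebesgue_on K) \<omega>) \<and>
     (AE x in lebesgue. \<omega> x > 0)"

definition is_cube :: "(real ^ 'n) set \<Rightarrow> bool" where
  "is_cube Q \<longleftrightarrow> (\<exists>a l. l > 0 \<and> Q = cbox a (\<chi> i. a $ i + l))"

definition average :: "'a::euclidean_space set \<Rightarrow> ('a \<Rightarrow> real) \<Rightarrow> real" where
  "average Q u = integral\<^sup>L (lebesgue_on Q) u / measure lebesgue Q"

(* The bound A forces the second average to be finite.  Since the Bochner integral of a
   non-integrable function is 0 in HOL, integrability has to be demanded separately. *)
definition Ap_weight :: "real \<Rightarrow> (real ^ 'n \<Rightarrow> real) \<Rightarrow> bool" where
  "Ap_weight p \<omega> \<longleftrightarrow> weight \<omega> \<and>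
     (\<exists>A>0. \<forall>Q. is_cube Q \<longrightarrow>
        integrable (lebesgue_on Q) (\<lambda>x. \<omega> x powr (- 1 / (p - 1))) \<and>
        average Q \<omega> * (average Q (\<lambda>x. \<omega> x powr (- 1 / (p - 1)))) powr (p - 1) \<le> A)"

definition M_R :: "('a::euclidean_space \<Rightarrow> real) \<Rightarrow> ('a \<Rightarrow> real) \<Rightarrow> 'a \<Rightarrow> ennreal" where
  "M_R R f x = (SUP r\<in>{0..R x}.
     if r = 0 then ennreal \<bar>f x\<bar>
     else (\<integral>\<^sup>+y\<in>ball x r. ennreal \<bar>f y\<bar> \<partial>lebesgue) / emeasure lebesgue (ball x r))"

(* On the diagonal, a null set, the value is 0 by the convention t / 0 = 0 or because g x - g x = 0. *)
definition S_R ::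
  "'a::euclidean_space set \<Rightarrow> real \<Rightarrow> ('a \<Rightarrow> real) \<Rightarrow> ('a \<Rightarrow> real) \<Rightarrow> 'a \<times> 'a \<Rightarrow> real" where
  "S_R G s R g = (\<lambda>(x, y). indicator G x * indicator G y * \<bar>g x - g y\<bar> /
     (norm (x - y) + \<bar>R x - R y\<bar>) powr s)"

definition S_0 ::
  "'a::euclidean_space set \<Rightarrow> real \<Rightarrow> ('a \<Rightarrow> real) \<Rightarrow> 'a \<times> 'a \<Rightarrow> real" where
  "S_0 G s g = S_R G s (\<lambda>_. 0) g"

(* pair_weight p w 0 and pair_weight p w 1 are the functions omega_0 and omega_1. *)
definition pair_weight ::
  "real \<Rightarrow> ('a::euclidean_space \<Rightarrow> real) \<Rightarrow> nat \<Rightarrow> 'a \<times> 'a \<Rightarrow> real" where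
  "pair_weight p \<omega> m = (\<lambda>(x, y). (if m = 0 then \<omega> (x - y) else \<omega> (y - x)) powr (1 / p))"

(* F takes values in [0, \<infinity>], so no absolute value is needed; real functions enter
   through ennreal. *)
definition M_dir ::
  "nat \<Rightarrow> nat \<Rightarrow> ('a::euclidean_space \<times> 'a \<Rightarrow> ennreal) \<Rightarrow> 'a \<times> 'a \<Rightarrow> ennreal" where
  "M_dir i j F = (\<lambda>(x, y). SUP r\<in>{0<..}.
     (\<integral>\<^sup>+z\<in>ball 0 r. F (x + real i *\<^sub>R z, y + real j *\<^sub>R z) \<partial>lebesgue) /
       emeasure lebesgue (ball (0::'a) r))"

end

theory Submission
  imports Defs
begin

text \<open>
  Put \<open>D = |x - y| + |R x - R y|\<close> and compare an average of \<open>|f|\<close> over \<open>B(x,r)\<close>, \<open>r \<le> R x\<close>, with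
  an admissible average at \<open>y\<close>. If \<open>r \<le> D\<close>, take the radius \<open>0\<close> at \<open>y\<close>; this costs \<open>M\<^sub>1\<^sub>0 (S f)\<close>. If
  \<open>r > D\<close>, take the radius \<open>t = r - D \<le> R y\<close>, put \<open>\<lambda> = t / r\<close>, and compare \<open>f (x + z)\<close> with
  \<open>f (y + \<lambda> z)\<close> through the mean of \<open>f\<close> over \<open>B(x + \<lambda> z, D)\<close>, a ball contained in \<open>B(x,r)\<close> and
  hence in \<open>G\<close>. The two errors are averages over \<open>z\<close> of \<open>M\<^sub>0\<^sub>1 (S f)\<close> and \<open>M\<^sub>1\<^sub>0 (S f)\<close> along the
  diagonal direction. The weight depends on \<open>x - y\<close> only, so it passes freely through the outer
  operators \<open>M\<^sub>1\<^sub>1\<close> and \<open>M\<^sub>0\<^sub>0\<close>. Since the estimate is symmetric and carried out in \<open>[0, \<infinity>]\<close>, points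
  where \<open>M\<^sub>R f = \<infinity>\<close> need no separate maximal theorem: if only one of the two values is infinite,
  so is the right-hand side.
\<close>

section \<open>Averages over balls\<close>

text \<open>Averages are centred at the origin and \<open>h\<close> carries the translation, which
  is the shape occurring in \<open>M_dir\<close>. Integrating against \<open>lborel\<close> gives
  the same values as the completed measure and makes Borel product measurability available.\<close>

definition ball_avg :: "real \<Rightarrow> ('a::euclidean_space \<Rightarrow> ennreal) \<Rightarrow> ennreal" where
  "ball_avg r h = (\<integral>\<^sup>+z\<in>ball 0 r. h z \<partial>lborel) / emeasure lborel (ball (0::'a) r)"

lemma ball_in_borel [measurable]: "ball x r \<in> sets borel"
  by simp

lemma M_dir_ball_avg:
  "M_dir i j F (x, y) = (SUP r\<in>{0<..}. ball_avg r (\<lambda>z. F (x + real i *\<^sub>R z, y + real j *\<^sub>R z)))"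
  by (simp add: M_dir_def ball_avg_def nn_integral_completion)

lemma ball_avg_le_M_dir:
  "r > 0 \<Longrightarrow> ball_avg r (\<lambda>z. F (x + real i *\<^sub>R z, y + real j *\<^sub>R z)) \<le> M_dir i j F (x, y)"
  unfolding M_dir_ball_avg by (rule SUP_upper) simp

lemma emeasure_ball_nontrivial:
  fixes x :: "'a::euclidean_space"
  assumes "r > 0"
  shows "emeasure lborel (ball x r) \<noteq> 0" "emeasure lborel (ball x r) \<noteq> \<infinity>"
  using assms by (simp_all add: emeasure_ball unit_ball_vol_pos[THEN less_imp_neq, symmetric])

lemma ball_avg_mono:
  assumes "\<And>z. z \<in> ball 0 r \<Longrightarrow> g z \<le> h z"
  shows "ball_avg r g \<le> ball_avg r h"
  unfolding ball_avg_def
  by (intro divide_right_mono_ennreal nn_integral_mono) (auto simp: indicator_def assms)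

lemma ball_avg_cong_AE:
  assumes "AE z in lborel. g z = h z"
  shows "ball_avg r g = ball_avg r h"
proof -
  have "(\<integral>\<^sup>+z\<in>ball 0 r. g z \<partial>lborel) = (\<integral>\<^sup>+z\<in>ball 0 r. h z \<partial>lborel)"
    by (rule nn_integral_cong_AE) (use assms in eventually_elim, simp)
  then show ?thesis by (simp add: ball_avg_def)
qed

lemma ball_avg_const:
  assumes "r > 0"
  shows "ball_avg r (\<lambda>_::'a::euclidean_space. c) = c"
proof -
  have "(\<integral>\<^sup>+z\<in>ball (0::'a) r. c \<partial>lborel) = c * emeasure lborel (ball (0::'a) r)"
    by (rule nn_integral_cmult_indicator) simp
  then show ?thesis
    using emeasure_ball_nontrivial[OF assms, of "0::'a"]
    by (simp add: ball_avg_def mult_divide_eq_ennreal)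
qed

lemma ball_avg_add:
  assumes "g \<in> borel_measurable borel" "h \<in> borel_measurable borel"
  shows "ball_avg r (\<lambda>z. g z + h z) = ball_avg r g + ball_avg r h"
proof -
  note [measurable] = assms
  have "(\<integral>\<^sup>+z\<in>ball 0 r. (g z + h z) \<partial>lborel) =
      (\<integral>\<^sup>+z\<in>ball 0 r. g z \<partial>lborel) + (\<integral>\<^sup>+z\<in>ball 0 r. h z \<partial>lborel)"
    unfolding distrib_right by (rule nn_integral_add) measurable
  then show ?thesis by (simp add: ball_avg_def add_divide_distrib_ennreal)
qed

lemma ball_avg_cmult:
  assumes "h \<in> borel_measurable borel"
  shows "ball_avg r (\<lambda>z. c * h z) = c * ball_avg r h"
proof -
  note [measurable] = assms
  have "(\<integral>\<^sup>+z\<in>ball 0 r. c * h z \<partial>lborel) = c * (\<integral>\<^sup>+z\<in>ball 0 r. h z \<partial>lborel)"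
    unfolding mult.assoc by (rule nn_integral_cmult) measurable
  then show ?thesis by (simp add: ball_avg_def ennreal_times_divide)
qed

section \<open>Affine changes of variables and comparison of balls\<close>

lemma nn_integral_lborel_affine:
  fixes h :: "'a::euclidean_space \<Rightarrow> ennreal"
  assumes [measurable]: "h \<in> borel_measurable borel" and "c > 0"
  shows "(\<integral>\<^sup>+z\<in>ball (a + c *\<^sub>R b) (c * r). h z \<partial>lborel) =
    ennreal (c ^ DIM('a)) * (\<integral>\<^sup>+z\<in>ball b r. h (a + c *\<^sub>R z) \<partial>lborel)"
proof -
  have ind: "indicator (ball (a + c *\<^sub>R b) (c * r)) (a + c *\<^sub>R z) = (indicator (ball b r) z :: ennreal)"
    for z
    using \<open>c > 0\<close>
    by (auto simp: indicator_def dist_norm simp flip: scaleR_diff_right)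
  have "(\<integral>\<^sup>+z\<in>ball (a + c *\<^sub>R b) (c * r). h z \<partial>lborel) =
      (\<integral>\<^sup>+z. ennreal (c ^ DIM('a)) * (h (a + c *\<^sub>R z) * indicator (ball b r) z) \<partial>lborel)"
  proof -
    let ?k = "\<lambda>z. h z * indicator (ball (a + c *\<^sub>R b) (c * r)) z"
    let ?D = "distr lborel borel (\<lambda>z. a + c *\<^sub>R z)"
    have [measurable]: "?k \<in> borel_measurable borel" by measurable
    have "(\<integral>\<^sup>+z. ?k z \<partial>lborel) = (\<integral>\<^sup>+z. ?k z \<partial>density ?D (\<lambda>_. ennreal (\<bar>c\<bar> ^ DIM('a))))"
      using \<open>c > 0\<close> by (subst lborel_affine[of c a]) auto
    also have "\<dots> = (\<integral>\<^sup>+z. ennreal (\<bar>c\<bar> ^ DIM('a)) * ?k z \<partial>?D)"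
      by (rule nn_integral_density) measurable
    also have "\<dots> = (\<integral>\<^sup>+z. ennreal (\<bar>c\<bar> ^ DIM('a)) * ?k (a + c *\<^sub>R z) \<partial>lborel)"
      by (rule nn_integral_distr) measurable
    finally show ?thesis using \<open>c > 0\<close> by (simp add: ind)
  qed
  also have "\<dots> = ennreal (c ^ DIM('a)) * (\<integral>\<^sup>+z\<in>ball b r. h (a + c *\<^sub>R z) \<partial>lborel)"
    by (rule nn_integral_cmult) measurable
  finally show ?thesis .
qed

lemma nn_integral_ball_translate:
  fixes h :: "'a::euclidean_space \<Rightarrow> ennreal"
  assumes "h \<in> borel_measurable borel"
  shows "(\<integral>\<^sup>+z\<in>ball (a + b) r. h z \<partial>lborel) = (\<integral>\<^sup>+z\<in>ball b r. h (a + z) \<partial>lborel)"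
  using nn_integral_lborel_affine[OF assms, of 1 a b r] by simp

lemma ball_avg_center:
  fixes h :: "'a::euclidean_space \<Rightarrow> ennreal"
  assumes "h \<in> borel_measurable borel" "r > 0"
  shows "(\<integral>\<^sup>+z\<in>ball x r. h z \<partial>lborel) / emeasure lborel (ball x r) = ball_avg r (\<lambda>z. h (x + z))"
  using nn_integral_ball_translate[OF assms(1), of x 0 r] assms(2)
  by (simp add: ball_avg_def emeasure_ball)

lemma ball_avg_scale:
  fixes h :: "'a::euclidean_space \<Rightarrow> ennreal"
  assumes "h \<in> borel_measurable borel" "c > 0" "r > 0"
  shows "ball_avg r (\<lambda>z. h (c *\<^sub>R z)) = ball_avg (c * r) h"
proof -
  have "emeasure lborel (ball (0::'a) (c * r)) = ennreal (c ^ DIM('a)) * emeasure lborel (ball (0::'a) r)"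
    using assms by (simp add: emeasure_ball power_mult_distrib mult_ac flip: ennreal_mult)
  then show ?thesis
    using nn_integral_lborel_affine[OF assms(1,2), of 0 0 r] \<open>c > 0\<close>
    by (simp add: ball_avg_def mult.commute[of "ennreal (c ^ DIM('a))"] divide_mult_eq)
qed

text \<open>The ball around \<open>a\<close> lies in the centred ball of radius
  \<open>c * r\<close>, whose volume is larger by the factor \<open>c ^ n\<close>. This turns
  off-centre averages into the centred ones that \<open>M_dir\<close> controls.\<close>

lemma ball_avg_enlarge:
  fixes h :: "'a::euclidean_space \<Rightarrow> ennreal"
  assumes [measurable]: "h \<in> borel_measurable borel" and "r > 0" "c > 0" and "norm a + r \<le> c * r"
  shows "ball_avg r (\<lambda>w. h (a + w)) \<le> ennreal (c ^ DIM('a)) * ball_avg (c * r) h"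
proof -
  have sub: "ball a r \<subseteq> ball 0 (c * r)"
    using assms(4) by (auto simp: dist_norm) (smt (verit) norm_triangle_sub norm_minus_commute)
  have "(\<integral>\<^sup>+w\<in>ball 0 r. h (a + w) \<partial>lborel) = (\<integral>\<^sup>+z\<in>ball a r. h z \<partial>lborel)"
    using nn_integral_ball_translate[OF assms(1), of a 0 r] by simp
  also have "\<dots> \<le> (\<integral>\<^sup>+z\<in>ball 0 (c * r). h z \<partial>lborel)"
    using sub by (intro nn_integral_mono) (auto simp: indicator_def)
  finally have 1: "ball_avg r (\<lambda>w. h (a + w)) \<le>
      (\<integral>\<^sup>+z\<in>ball 0 (c * r). h z \<partial>lborel) / emeasure lborel (ball (0::'a) r)"
    unfolding ball_avg_def by (rule divide_right_mono_ennreal)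
  have "emeasure lborel (ball (0::'a) (c * r)) = ennreal (c ^ DIM('a)) * emeasure lborel (ball (0::'a) r)"
    using assms by (simp add: emeasure_ball power_mult_distrib mult_ac flip: ennreal_mult)
  then have "(\<integral>\<^sup>+z\<in>ball 0 (c * r). h z \<partial>lborel) / emeasure lborel (ball (0::'a) r) =
      ennreal (c ^ DIM('a)) * ball_avg (c * r) h"
    using \<open>c > 0\<close>
    by (simp add: ball_avg_def ennreal_times_divide mult.commute[of "ennreal (c ^ DIM('a))"] divide_mult_eq)
  with 1 show ?thesis by simp
qed

text \<open>With both indices 0 the integrand is constant in the integration variable.\<close>

lemma M_dir_0_0: "M_dir 0 0 F q = F q"
proof (cases q)
  case (Pair x y)
  have "(SUP r\<in>{0<..}. ball_avg r (\<lambda>z::'a. F (x, y))) = (SUP r\<in>{(0::real)<..}. F (x, y))"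
    by (rule SUP_cong) (auto simp: ball_avg_const)
  also have "\<dots> = F (x, y)" by (rule SUP_const) auto
  finally show ?thesis by (simp add: Pair M_dir_ball_avg)
qed

text \<open>Tonelli measurability, needed because averages over the intermediate point are
  themselves averaged along the diagonal.\<close>

lemma borel_measurable_ball_avg:
  fixes h :: "'a::euclidean_space \<Rightarrow> 'b::euclidean_space \<Rightarrow> ennreal"
  assumes [measurable]: "case_prod h \<in> borel_measurable (borel \<Otimes>\<^sub>M borel)"
  shows "(\<lambda>z. ball_avg r (h z)) \<in> borel_measurable borel"
  unfolding ball_avg_def by measurable

section \<open>The pointwise estimate for Borel functions\<close>

lemma S_0_eq:
  "S_0 G s f (u, v) = indicator G u * indicator G v * \<bar>f u - f v\<bar> / norm (u - v) powr s"
  by (simp add: S_0_def S_R_def)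

lemma borel_measurable_S_0:
  fixes f :: "'a::euclidean_space \<Rightarrow> real"
  assumes [measurable]: "f \<in> borel_measurable borel" and "open G"
  shows "S_0 G s f \<in> borel_measurable (borel \<Otimes>\<^sub>M borel)"
proof -
  have [measurable]: "G \<in> sets borel" using \<open>open G\<close> by simp
  have "S_0 G s f = (\<lambda>q. indicator G (fst q) * indicator G (snd q) * \<bar>f (fst q) - f (snd q)\<bar> /
      norm (fst q - snd q) powr s)"
    by (auto simp: S_0_eq)
  also have "\<dots> \<in> borel_measurable (borel \<Otimes>\<^sub>M borel)" by measurable
  finally show ?thesis .
qed

text \<open>Since \<open>0 \<le> s\<close>, the denominator of \<open>S_0\<close> is at most
  \<open>(4 * D) powr s\<close>, and \<open>s \<le> 2\<close> bounds \<open>4 powr s\<close> by 16,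
  a constant free of \<open>s\<close>. The pairs compared below are at distance at most 2D, so 4D
  leaves room.\<close>

lemma abs_diff_le_S_0:
  assumes "u \<in> G" "v \<in> G" "norm (u - v) \<le> 4 * D" "0 < D" "0 \<le> s" "s \<le> 2"
  shows "ennreal \<bar>f u - f v\<bar> \<le> ennreal (16 * D powr s) * ennreal (S_0 G s f (u, v))"
proof (cases "u = v")
  case False
  have "norm (u - v) powr s \<le> (4 * D) powr s"
    using assms by (intro powr_mono2) auto
  also have "\<dots> = 4 powr s * D powr s"
    using assms by (simp add: powr_mult)
  also have "\<dots> \<le> 4 powr 2 * D powr s"
    using assms by (intro mult_right_mono powr_mono) auto
  finally have "norm (u - v) powr s \<le> 16 * D powr s" by simp
  then have "\<bar>f u - f v\<bar> * norm (u - v) powr s \<le> \<bar>f u - f v\<bar> * (16 * D powr s)"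
    by (rule mult_left_mono) simp
  then have "\<bar>f u - f v\<bar> \<le> 16 * D powr s * S_0 G s f (u, v)"
    using assms False by (simp add: S_0_eq field_simps)
  then show ?thesis by (simp flip: ennreal_mult' add: ennreal_leI)
qed simp

lemma abs_le_abs_add_S_0:
  assumes "u \<in> G" "v \<in> G" "norm (u - v) \<le> 4 * D" "0 < D" "0 \<le> s" "s \<le> 2"
  shows "ennreal \<bar>f u\<bar> \<le> ennreal \<bar>f v\<bar> + ennreal (16 * D powr s) * ennreal (S_0 G s f (u, v))"
proof -
  have "ennreal \<bar>f u\<bar> \<le> ennreal (\<bar>f v\<bar> + \<bar>f u - f v\<bar>)" by (rule ennreal_leI) linarith
  also have "\<dots> = ennreal \<bar>f v\<bar> + ennreal \<bar>f u - f v\<bar>" by simp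
  also have "\<dots> \<le> ennreal \<bar>f v\<bar> + ennreal (16 * D powr s) * ennreal (S_0 G s f (u, v))"
    using assms by (intro add_left_mono abs_diff_le_S_0)
  finally show ?thesis .
qed

text \<open>Each point of the ball is within 2D of \<open>y\<close>, so \<open>f y\<close> serves as
  a direct comparison value. Only the first variable of \<open>S_0\<close> moves, hence an average
  of the kind in \<open>M_dir 1 0\<close>.\<close>

lemma ball_avg_small_radius:
  fixes f :: "'a::euclidean_space \<Rightarrow> real"
  assumes f [measurable]: "f \<in> borel_measurable borel" and "open G" and s: "0 \<le> s" "s \<le> 2"
    and r: "0 < r" "r \<le> D" and xy: "norm (x - y) \<le> D" and sub: "ball x r \<subseteq> G" "y \<in> G"
  shows "ball_avg r (\<lambda>z. ennreal \<bar>f (x + z)\<bar>) \<le>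
    ennreal \<bar>f y\<bar> + ennreal (16 * D powr s) * ball_avg r (\<lambda>z. ennreal (S_0 G s f (x + z, y)))"
proof -
  have [measurable]: "S_0 G s f \<in> borel_measurable (borel \<Otimes>\<^sub>M borel)"
    using f \<open>open G\<close> by (rule borel_measurable_S_0)
  have "ball_avg r (\<lambda>z. ennreal \<bar>f (x + z)\<bar>) \<le>
      ball_avg r (\<lambda>z. ennreal \<bar>f y\<bar> + ennreal (16 * D powr s) * ennreal (S_0 G s f (x + z, y)))"
  proof (rule ball_avg_mono)
    fix z :: 'a assume z: "z \<in> ball 0 r"
    have "norm (x + z - y) \<le> norm (x - y) + norm z"
      using norm_triangle_ineq[of "x - y" z] by (simp add: algebra_simps)
    then show "ennreal \<bar>f (x + z)\<bar> \<le>
        ennreal \<bar>f y\<bar> + ennreal (16 * D powr s) * ennreal (S_0 G s f (x + z, y))"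
      using z sub r xy s by (intro abs_le_abs_add_S_0) (auto simp: subset_iff dist_norm)
  qed
  also have "\<dots> = ball_avg r (\<lambda>z::'a. ennreal \<bar>f y\<bar>) +
      ball_avg r (\<lambda>z. ennreal (16 * D powr s) * ennreal (S_0 G s f (x + z, y)))"
    by (rule ball_avg_add) measurable
  also have "\<dots> = ennreal \<bar>f y\<bar> +
      ennreal (16 * D powr s) * ball_avg r (\<lambda>z. ennreal (S_0 G s f (x + z, y)))"
    using r by (subst ball_avg_cmult) (simp_all add: ball_avg_const)
  finally show ?thesis .
qed

text \<open>The contraction z -> lz with l = (r - D)/r carries the ball of radius r onto that of
  radius r - D. Passing from x + z to y + lz through u = x + lz + w, |w| < D, changes one variable
  of \<open>S_0\<close> at a time, while the outer shift moves both variables equally.\<close>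

lemma ball_avg_large_radius:
  fixes f :: "'a::euclidean_space \<Rightarrow> real"
  defines "n \<equiv> DIM('a)"
  assumes f [measurable]: "f \<in> borel_measurable borel" and "open G" and s: "0 \<le> s" "s \<le> 2"
    and r: "0 < D" "D < r" and xy: "norm (x - y) \<le> D"
    and sub: "ball x r \<subseteq> G" "ball y (r - D) \<subseteq> G"
  shows "ball_avg r (\<lambda>z. ennreal \<bar>f (x + z)\<bar>) \<le>
    ball_avg (r - D) (\<lambda>z. ennreal \<bar>f (y + z)\<bar>) + ennreal (16 * D powr s) *
      (ennreal (3 ^ n) * ball_avg r (\<lambda>z. ball_avg (3 * D) (\<lambda>a. ennreal (S_0 G s f (x + z, y + z + a)))) +
       ball_avg (r - D) (\<lambda>z. ball_avg D (\<lambda>w. ennreal (S_0 G s f (x + z + w, y + z)))))"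
proof -
  define H where "H = (\<lambda>q. ennreal (S_0 G s f q))"
  define K where "K = ennreal (16 * D powr s)"
  define l where "l = (r - D) / r"
  \<comment> \<open>\<open>P\<close> and \<open>Q\<close> are centred at diagonal translates of
    \<open>(x, y)\<close>, so that an average of them in z falls under \<open>M_dir 1 1\<close>. In
    \<open>P\<close> the radius is 3D because recentring at y + z displaces the ball of radius D by
    at most 2D.\<close>
  define P where "P = (\<lambda>z. ball_avg (3 * D) (\<lambda>a. H (x + z, y + z + a)))"
  define Q where "Q = (\<lambda>z. ball_avg D (\<lambda>w. H (x + z + w, y + z)))"
  have l: "0 < l" "l \<le> 1" "l * r = r - D" "(1 - l) * r = D"
    using r by (auto simp: l_def field_simps)
  have [measurable]: "S_0 G s f \<in> borel_measurable (borel \<Otimes>\<^sub>M borel)"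
    using f \<open>open G\<close> by (rule borel_measurable_S_0)
  have H [measurable]: "H \<in> borel_measurable (borel \<Otimes>\<^sub>M borel)"
    unfolding H_def by measurable
  have [measurable]: "P \<in> borel_measurable borel" "Q \<in> borel_measurable borel"
    unfolding P_def Q_def by (rule borel_measurable_ball_avg; measurable)+
  have pointwise: "ennreal \<bar>f (x + z)\<bar> \<le>
      ennreal \<bar>f (y + l *\<^sub>R z)\<bar> + K * (ennreal (3 ^ n) * P z + Q (l *\<^sub>R z))"
    if z: "z \<in> ball 0 r" for z
  proof -
    have lz: "norm (l *\<^sub>R z) < r - D" "norm ((1 - l) *\<^sub>R z) \<le> D"
      using z l mult_strict_left_mono[of "norm z" r l] mult_left_mono[of "norm z" r "1 - l"] by auto
    have inG: "x + z \<in> G" "y + l *\<^sub>R z \<in> G"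
      using sub z lz by (auto simp: subset_iff dist_norm)
    \<comment> \<open>Both end values are constant in \<open>w\<close>, so averaging over the
      intermediate point leaves them unchanged and affects only the two error terms.\<close>
    have "ball_avg D (\<lambda>w::'a. ennreal \<bar>f (x + z)\<bar>) \<le>
        ball_avg D (\<lambda>w. ennreal \<bar>f (y + l *\<^sub>R z)\<bar> +
          K * (H (x + z, x + l *\<^sub>R z + w) + H (x + l *\<^sub>R z + w, y + l *\<^sub>R z)))"
    proof (rule ball_avg_mono)
      fix w :: 'a assume w: "w \<in> ball 0 D"
      let ?u = "x + l *\<^sub>R z + w"
      \<comment> \<open>The bounds |lz| < r - D and |w| < D keep the intermediate point inside the
        ball of radius r about x, hence in \<open>G\<close>.\<close>
      have "norm (l *\<^sub>R z + w) < r"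
        using norm_triangle_ineq[of "l *\<^sub>R z" w] lz w by simp
      then have u: "?u \<in> G"
        using sub(1) by (auto simp: subset_iff dist_norm add.assoc norm_minus_commute)
      have "x + z - ?u = (1 - l) *\<^sub>R z - w" by (simp add: algebra_simps)
      moreover have "norm ((1 - l) *\<^sub>R z - w) \<le> 4 * D"
        using norm_triangle_ineq4[of "(1 - l) *\<^sub>R z" w] lz w r by simp
      ultimately have 1: "norm (x + z - ?u) \<le> 4 * D" by (simp only:)
      have "?u - (y + l *\<^sub>R z) = (x - y) + w" by (simp add: algebra_simps)
      moreover have "norm ((x - y) + w) \<le> 4 * D"
        using norm_triangle_ineq[of "x - y" w] xy w r by simp
      ultimately have 2: "norm (?u - (y + l *\<^sub>R z)) \<le> 4 * D" by (simp only:)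
      have "ennreal \<bar>f (x + z)\<bar> \<le> ennreal \<bar>f ?u\<bar> + K * H (x + z, ?u)"
        unfolding K_def H_def using inG u 1 r s by (intro abs_le_abs_add_S_0) auto
      also have "ennreal \<bar>f ?u\<bar> \<le> ennreal \<bar>f (y + l *\<^sub>R z)\<bar> + K * H (?u, y + l *\<^sub>R z)"
        unfolding K_def H_def using inG u 2 r s by (intro abs_le_abs_add_S_0) auto
      finally show "ennreal \<bar>f (x + z)\<bar> \<le> ennreal \<bar>f (y + l *\<^sub>R z)\<bar> +
          K * (H (x + z, ?u) + H (?u, y + l *\<^sub>R z))"
        by (simp add: distrib_left add_ac)
    qed
    also have "\<dots> = ball_avg D (\<lambda>w::'a. ennreal \<bar>f (y + l *\<^sub>R z)\<bar>) +
        ball_avg D (\<lambda>w. K * (H (x + z, x + l *\<^sub>R z + w) + H (x + l *\<^sub>R z + w, y + l *\<^sub>R z)))"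
      by (rule ball_avg_add) measurable
    also have "ball_avg D (\<lambda>w. K * (H (x + z, x + l *\<^sub>R z + w) + H (x + l *\<^sub>R z + w, y + l *\<^sub>R z))) =
        K * ball_avg D (\<lambda>w. H (x + z, x + l *\<^sub>R z + w) + H (x + l *\<^sub>R z + w, y + l *\<^sub>R z))"
      by (rule ball_avg_cmult) measurable
    also have "ball_avg D (\<lambda>w. H (x + z, x + l *\<^sub>R z + w) + H (x + l *\<^sub>R z + w, y + l *\<^sub>R z)) =
        ball_avg D (\<lambda>w. H (x + z, x + l *\<^sub>R z + w)) + Q (l *\<^sub>R z)"
      unfolding Q_def by (rule ball_avg_add) measurable
    also have "ball_avg D (\<lambda>w. H (x + z, x + l *\<^sub>R z + w)) \<le> ennreal (3 ^ n) * P z"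
    proof -
      \<comment> \<open>\<open>?a\<close> is the centre x + lz seen from y + z. Its norm is at most
        |x - y| + (1 - l)|z|, that is, at most 2D.\<close>
      let ?a = "(x - y) - (1 - l) *\<^sub>R z"
      have "norm ?a + D \<le> 3 * D"
        using norm_triangle_ineq4[of "x - y" "(1 - l) *\<^sub>R z"] lz xy by simp
      then have "ball_avg D (\<lambda>w. H (x + z, y + z + (?a + w))) \<le> ennreal (3 ^ n) * P z"
        unfolding P_def n_def using r
        by (intro ball_avg_enlarge[where h = "\<lambda>a. H (x + z, y + z + a)"]) simp_all
      moreover have "y + z + (?a + w) = x + l *\<^sub>R z + w" for w
        by (simp add: algebra_simps)
      ultimately show ?thesis by simp
    qed
    finally show ?thesis
      using r by (simp add: ball_avg_const add_left_mono add_right_mono mult_left_mono)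
  qed
  have "ball_avg r (\<lambda>z. ennreal \<bar>f (x + z)\<bar>) \<le>
      ball_avg r (\<lambda>z. ennreal \<bar>f (y + l *\<^sub>R z)\<bar> + K * (ennreal (3 ^ n) * P z + Q (l *\<^sub>R z)))"
    by (rule ball_avg_mono) (rule pointwise)
  also have "\<dots> = ball_avg r (\<lambda>z. ennreal \<bar>f (y + l *\<^sub>R z)\<bar>) +
      ball_avg r (\<lambda>z. K * (ennreal (3 ^ n) * P z + Q (l *\<^sub>R z)))"
    by (rule ball_avg_add) measurable
  also have "ball_avg r (\<lambda>z. K * (ennreal (3 ^ n) * P z + Q (l *\<^sub>R z))) =
      K * ball_avg r (\<lambda>z. ennreal (3 ^ n) * P z + Q (l *\<^sub>R z))"
    by (rule ball_avg_cmult) measurable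
  also have "ball_avg r (\<lambda>z. ennreal (3 ^ n) * P z + Q (l *\<^sub>R z)) =
      ball_avg r (\<lambda>z. ennreal (3 ^ n) * P z) + ball_avg r (\<lambda>z. Q (l *\<^sub>R z))"
    by (rule ball_avg_add) measurable
  also have "ball_avg r (\<lambda>z. ennreal (3 ^ n) * P z) = ennreal (3 ^ n) * ball_avg r P"
    by (rule ball_avg_cmult) measurable
  \<comment> \<open>The substitution z -> lz shrinks the radius from r to
    \<open>l * r = r - D\<close>; the Jacobian cancels against the ratio of the volumes.\<close>
  also have "ball_avg r (\<lambda>z. Q (l *\<^sub>R z)) = ball_avg (r - D) Q"
    using l r by (subst ball_avg_scale) auto
  also have "ball_avg r (\<lambda>z. ennreal \<bar>f (y + l *\<^sub>R z)\<bar>) = ball_avg (r - D) (\<lambda>z. ennreal \<bar>f (y + z)\<bar>)"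
    using l r by (subst ball_avg_scale[where h = "\<lambda>z. ennreal \<bar>f (y + z)\<bar>"]) auto
  finally show ?thesis by (simp add: P_def Q_def H_def K_def)
qed

section \<open>From ball averages to the restricted maximal function\<close>

lemma M_R_le_mult:
  assumes f: "f \<in> borel_measurable borel"
    and "c * ennreal \<bar>f x\<bar> \<le> B"
    and "\<And>r. 0 < r \<Longrightarrow> r \<le> R x \<Longrightarrow> c * ball_avg r (\<lambda>z. ennreal \<bar>f (x + z)\<bar>) \<le> B"
  shows "c * M_R R f x \<le> B"
  unfolding M_R_def SUP_mult_left_ennreal nn_integral_completion
\<comment> \<open>Multiplication by a constant commutes with suprema in [0, \<infinity>], so the
  bound is checked radius by radius, radius 0 giving \<open>\<bar>f x\<bar>\<close>.\<close>
proof (rule SUP_least)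
  fix r assume "r \<in> {0..R x}"
  then show "c * (if r = 0 then ennreal \<bar>f x\<bar>
      else (\<integral>\<^sup>+y\<in>ball x r. ennreal \<bar>f y\<bar> \<partial>lborel) / emeasure lebesgue (ball x r)) \<le> B"
    using assms(2) assms(3)[of r] ball_avg_center[of "\<lambda>y. ennreal \<bar>f y\<bar>" r x] f by auto
qed

lemma abs_le_M_R: "0 \<le> R x \<Longrightarrow> ennreal \<bar>f x\<bar> \<le> M_R R f x"
  unfolding M_R_def by (rule SUP_upper2[of 0]) auto

lemma ball_avg_le_M_R:
  assumes "f \<in> borel_measurable borel" "0 < r" "r \<le> R x"
  shows "ball_avg r (\<lambda>z. ennreal \<bar>f (x + z)\<bar>) \<le> M_R R f x"
  unfolding M_R_def nn_integral_completion
  using assms ball_avg_center[of "\<lambda>y. ennreal \<bar>f y\<bar>" r x] by (intro SUP_upper2[of r]) auto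

text \<open>A ball is connected: if it meets both \<open>G\<close> and its complement, it meets the
  frontier at distance less than its radius from the centre.\<close>

lemma ball_subset_bdry_dist:
  assumes "x \<in> G" "ereal \<rho> \<le> bdry_dist G x" "r \<le> \<rho>"
  shows "ball x r \<subseteq> G"
proof (rule ccontr)
  assume not: "\<not> ball x r \<subseteq> G"
  then have "0 < r" using ball_empty[of r x] by fastforce
  have "G \<noteq> UNIV" using not by auto
  have "x \<in> ball x r \<inter> G" using \<open>0 < r\<close> assms(1) by simp
  then have "ball x r \<inter> frontier G \<noteq> {}"
    using not by (intro connected_Int_frontier) (simp, blast, blast)
  then obtain z where "z \<in> frontier G" "dist x z < r" by auto
  then have "infdist x (frontier G) < r"
    using infdist_le[of z "frontier G" x] by linarith
  with assms(2,3) \<open>G \<noteq> UNIV\<close> show False by (simp add: bdry_dist_def)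
qed

text \<open>One half of the symmetric estimate, in additive form so that infinite values are
  allowed. \<open>W\<close> stands for any common bound of the operator terms, which keeps the
  finite sum out of the argument. In the constant, 16 comes from \<open>abs_diff_le_S_0\<close>,
  \<open>3 ^ n\<close> from the enlarged ball and 1 from the other error.\<close>

lemma M_R_compare:
  fixes f :: "'a::euclidean_space \<Rightarrow> real" and R :: "'a \<Rightarrow> real"
  defines "D x y \<equiv> norm (x - y) + \<bar>R x - R y\<bar>"
  assumes f [measurable]: "f \<in> borel_measurable borel" and "open G" and s: "0 \<le> s" "s \<le> 2"
    and R: "\<And>x. x \<in> G \<Longrightarrow> 0 \<le> R x \<and> ereal (R x) \<le> bdry_dist G x"
    and xy: "x \<in> G" "y \<in> G" "x \<noteq> y"
    and W: "\<And>i j k l. {i, j, k, l} \<subseteq> {0, 1} \<Longrightarrow> k * l = 0 \<Longrightarrow>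
      M_dir i j (\<lambda>q. ennreal (pair_weight p \<omega> m q) * M_dir k l (\<lambda>q'. ennreal (S_0 G s f q')) q) (x, y) \<le> W"
  shows "ennreal (pair_weight p \<omega> m (x, y)) * M_R R f x \<le>
    ennreal (pair_weight p \<omega> m (x, y)) * M_R R f y +
    ennreal (16 * (3 ^ DIM('a) + 1) * D x y powr s) * W"
proof -
  define H where "H = (\<lambda>q. ennreal (S_0 G s f q))"
  define d where "d = D x y"
  define K where "K = ennreal (16 * d powr s)"
  define c where "c = ennreal (pair_weight p \<omega> m (x, y))"
  let ?n = "DIM('a)"
  have d: "0 < d" "norm (x - y) \<le> d" using xy by (auto simp: d_def D_def intro: add_pos_nonneg)
  have [measurable]: "S_0 G s f \<in> borel_measurable (borel \<Otimes>\<^sub>M borel)"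
    using f \<open>open G\<close> by (rule borel_measurable_S_0)
  have H [measurable]: "H \<in> borel_measurable (borel \<Otimes>\<^sub>M borel)"
    unfolding H_def by measurable
  have c_diag: "ennreal (pair_weight p \<omega> m (x + z, y + z)) = c" for z
    by (simp add: c_def pair_weight_def)
  have W00: "c * M_dir k l H (x, y) \<le> W" if "{k, l} \<subseteq> {0, 1}" "k * l = 0" for k l
    using W[of 0 0 k l] that by (simp add: M_dir_0_0 c_def H_def)
  \<comment> \<open>The factor \<open>c\<close> moves inside the average, where it equals the weight
    at every diagonal translate; the result is one of the averages in the supremum
    \<open>M_dir 1 1\<close>.\<close>
  have W11: "c * ball_avg r P \<le> W"
    if "{k, l} \<subseteq> {0, 1}" "k * l = 0" "0 < r" and [measurable]: "P \<in> borel_measurable borel"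
      and P: "\<And>z. P z \<le> M_dir k l H (x + z, y + z)" for k l r P
  proof -
    have "c * ball_avg r P = ball_avg r (\<lambda>z. c * P z)"
      by (rule ball_avg_cmult[symmetric]) measurable
    also have "\<dots> \<le> ball_avg r (\<lambda>z. ennreal (pair_weight p \<omega> m (x + z, y + z)) * M_dir k l H (x + z, y + z))"
      by (rule ball_avg_mono) (simp add: c_diag P mult_left_mono)
    also have "\<dots> \<le> M_dir 1 1 (\<lambda>q. ennreal (pair_weight p \<omega> m q) * M_dir k l H q) (x, y)"
      using ball_avg_le_M_dir[OF \<open>0 < r\<close>, where i = 1 and j = 1 and x = x and y = y
        and F = "\<lambda>q. ennreal (pair_weight p \<omega> m q) * M_dir k l H q"] by simp
    also have "\<dots> \<le> W" using W[of 1 1 k l] that(1,2) by (simp add: H_def)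
    finally show ?thesis .
  qed
  have K_le: "K * (ennreal (3 ^ ?n) * W + W) = ennreal (16 * (3 ^ ?n + 1) * d powr s) * W"
  proof -
    have "K * (ennreal (3 ^ ?n) * W + W) = ennreal (16 * d powr s) * ennreal (3 ^ ?n + 1) * W"
      by (simp add: K_def distrib_right mult.assoc)
    also have "ennreal (16 * d powr s) * ennreal (3 ^ ?n + 1) = ennreal (16 * (3 ^ ?n + 1) * d powr s)"
      by (subst ennreal_mult[symmetric]) (simp_all add: mult_ac)
    finally show ?thesis .
  qed
  have K_W: "K * W \<le> ennreal (16 * (3 ^ ?n + 1) * d powr s) * W"
    unfolding K_le[symmetric] by (intro mult_left_mono) auto
  \<comment> \<open>Common ending for radius 0 and for radii up to \<open>d\<close>: the comparison
    value \<open>\<bar>f y\<bar>\<close> is the radius 0 term of \<open>M_R R f y\<close>.\<close>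
  have near: "c * A \<le> c * M_R R f y + ennreal (16 * (3 ^ ?n + 1) * d powr s) * W"
    if A: "A \<le> ennreal \<bar>f y\<bar> + K * E" and E: "c * E \<le> W" for A E
  proof -
    have "c * A \<le> c * ennreal \<bar>f y\<bar> + K * (c * E)"
      using mult_left_mono[OF A, of c] by (simp add: distrib_left mult_ac)
    also have "\<dots> \<le> c * M_R R f y + K * W"
      using R xy by (intro add_mono mult_left_mono E abs_le_M_R) auto
    also have "\<dots> \<le> c * M_R R f y + ennreal (16 * (3 ^ ?n + 1) * d powr s) * W"
      by (rule add_left_mono) (rule K_W)
    finally show ?thesis .
  qed
  have "c * M_R R f x \<le> c * M_R R f y + ennreal (16 * (3 ^ ?n + 1) * d powr s) * W"
  proof (rule M_R_le_mult[OF f])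
    show "c * ennreal \<bar>f x\<bar> \<le> c * M_R R f y + ennreal (16 * (3 ^ ?n + 1) * d powr s) * W"
    proof (rule near)
      show "ennreal \<bar>f x\<bar> \<le> ennreal \<bar>f y\<bar> + K * H (x, y)"
        unfolding K_def H_def using xy d s by (intro abs_le_abs_add_S_0) auto
      show "c * H (x, y) \<le> W" using W00[of 0 0] by (simp add: M_dir_0_0)
    qed
  next
    fix r assume r: "0 < r" "r \<le> R x"
    have ballx: "ball x r \<subseteq> G" using R xy r by (intro ball_subset_bdry_dist) auto
    show "c * ball_avg r (\<lambda>z. ennreal \<bar>f (x + z)\<bar>) \<le>
        c * M_R R f y + ennreal (16 * (3 ^ ?n + 1) * d powr s) * W"
    proof (cases "r \<le> d")
      case True
      show ?thesis
      proof (rule near)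
        show "ball_avg r (\<lambda>z. ennreal \<bar>f (x + z)\<bar>) \<le>
            ennreal \<bar>f y\<bar> + K * ball_avg r (\<lambda>z. H (x + z, y))"
          unfolding K_def H_def using f \<open>open G\<close> s r(1) True d(2) ballx xy(2)
          by (rule ball_avg_small_radius)
        have "c * ball_avg r (\<lambda>z. H (x + z, y)) \<le> c * M_dir 1 0 H (x, y)"
          using ball_avg_le_M_dir[OF r(1), where i = 1 and j = 0 and F = H and x = x and y = y]
          by (intro mult_left_mono) auto
        also have "\<dots> \<le> W" by (rule W00) auto
        finally show "c * ball_avg r (\<lambda>z. H (x + z, y)) \<le> W" .
      qed
    next
      case False
      define P where "P = (\<lambda>z. ball_avg (3 * d) (\<lambda>a. H (x + z, y + z + a)))"
      define Q where "Q = (\<lambda>z. ball_avg d (\<lambda>w. H (x + z + w, y + z)))"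
      \<comment> \<open>Here the summand \<open>\<bar>R x - R y\<bar>\<close> of \<open>d\<close> is
        used: r - d \<le> R x - |R x - R y| \<le> R y, so r - d is admissible at y.\<close>
      have rd: "0 < r - d" "r - d \<le> R y"
        using False r norm_ge_zero[of "x - y"] unfolding d_def D_def by linarith+
      have bally: "ball y (r - d) \<subseteq> G" using R xy rd by (intro ball_subset_bdry_dist) auto
      have [measurable]: "P \<in> borel_measurable borel" "Q \<in> borel_measurable borel"
        unfolding P_def Q_def by (rule borel_measurable_ball_avg; measurable)+
      have P: "P z \<le> M_dir 0 1 H (x + z, y + z)" for z
        using ball_avg_le_M_dir[of "3 * d", where i = 0 and j = 1 and F = H and x = "x + z" and y = "y + z"] d
        by (simp add: P_def)
      have Q: "Q z \<le> M_dir 1 0 H (x + z, y + z)" for z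
        using ball_avg_le_M_dir[of d, where i = 1 and j = 0 and F = H and x = "x + z" and y = "y + z"] d
        by (simp add: Q_def)
      have "ball_avg r (\<lambda>z. ennreal \<bar>f (x + z)\<bar>) \<le> ball_avg (r - d) (\<lambda>z. ennreal \<bar>f (y + z)\<bar>) +
          K * (ennreal (3 ^ ?n) * ball_avg r P + ball_avg (r - d) Q)"
        unfolding K_def P_def Q_def H_def
        by (rule ball_avg_large_radius) (use f \<open>open G\<close> s d False ballx bally in auto)
      from mult_left_mono[OF this, of c]
      have "c * ball_avg r (\<lambda>z. ennreal \<bar>f (x + z)\<bar>) \<le> c * ball_avg (r - d) (\<lambda>z. ennreal \<bar>f (y + z)\<bar>) +
          K * (ennreal (3 ^ ?n) * (c * ball_avg r P) + c * ball_avg (r - d) Q)"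
        by (simp add: distrib_left mult_ac)
      also have "\<dots> \<le> c * M_R R f y + K * (ennreal (3 ^ ?n) * W + W)"
        using f r rd P Q
        by (intro add_mono mult_left_mono ball_avg_le_M_R W11[of 0 1 r P] W11[of 1 0 "r - d" Q]) auto
      finally show ?thesis by (simp only: K_le)
    qed
  qed
  then show ?thesis by (simp add: c_def d_def)
qed

section \<open>Passage to Lebesgue measurable functions\<close>

lemma AE_lborel_translate:
  fixes N :: "'a::euclidean_space set"
  assumes "N \<in> null_sets lborel"
  shows "AE z in lborel. x + z \<notin> N"
proof -
  have [measurable]: "N \<in> sets borel" using assms by auto
  have "AE z in distr lborel borel ((+) x). z \<notin> N"
    unfolding lborel_distr_plus by (rule AE_not_in[OF assms])
  then show ?thesis by (subst (asm) AE_distr_iff) auto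
qed

text \<open>\<open>M_dir\<close> integrates over slices, which a null set of pairs could contain
  entirely. A null set \<open>N\<close> of single points avoids this: a coordinate with index 0
  stays at a point off \<open>N\<close>, and one with index 1 is a translate that misses
  \<open>N\<close> for almost every z. The conclusion again holds off \<open>N\<close>, so the lemma
  can be iterated.\<close>

lemma M_dir_cong_off_null:
  fixes N :: "'a::euclidean_space set"
  assumes N: "N \<in> null_sets lborel" and ij: "{i, j} \<subseteq> {0, 1}" and xy: "x \<notin> N" "y \<notin> N"
    and eq: "\<And>u v. u \<notin> N \<Longrightarrow> v \<notin> N \<Longrightarrow> F (u, v) = F' (u, v)"
  shows "M_dir i j F (x, y) = M_dir i j F' (x, y)"
proof -
  have "AE z in lborel. u + real k *\<^sub>R z \<notin> N" if "k \<in> {0, 1}" "u \<notin> N" for k :: nat and u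
    using that AE_lborel_translate[OF N, of u] by auto
  then have "AE z in lborel. x + real i *\<^sub>R z \<notin> N" "AE z in lborel. y + real j *\<^sub>R z \<notin> N"
    using ij xy by auto
  then have "AE z in lborel. F (x + real i *\<^sub>R z, y + real j *\<^sub>R z) = F' (x + real i *\<^sub>R z, y + real j *\<^sub>R z)"
    by eventually_elim (rule eq)
  then show ?thesis
    unfolding M_dir_ball_avg by (intro SUP_cong refl ball_avg_cong_AE)
qed

text \<open>All admissible balls lie in \<open>G\<close>, so almost everywhere equality there
  settles positive radii; radius 0 requires equality at \<open>x\<close> itself.\<close>

lemma M_R_cong_AE:
  assumes "AE z in lborel. z \<in> G \<longrightarrow> f z = g z" "f x = g x"
    and "x \<in> G" "ereal (R x) \<le> bdry_dist G x"
  shows "M_R R f x = M_R R g x"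
  unfolding M_R_def nn_integral_completion
proof (intro SUP_cong refl if_cong arg_cong[where f = "\<lambda>I. I / _"] nn_integral_cong_AE)
  fix r assume "r \<in> {0..R x}"
  then have "ball x r \<subseteq> G" using assms by (intro ball_subset_bdry_dist) auto
  then have sub: "y \<in> ball x r \<Longrightarrow> y \<in> G" for y by blast
  show "AE y in lborel. ennreal \<bar>f y\<bar> * indicator (ball x r) y = ennreal \<bar>g y\<bar> * indicator (ball x r) y"
    using assms(1)
  proof eventually_elim
    case (elim y)
    then show ?case using sub[of y] by (cases "y \<in> ball x r") simp_all
  qed
qed (use assms in simp)

lemma ex_borel_off_null:
  fixes f :: "'a::euclidean_space \<Rightarrow> real"
  assumes f: "f \<in> borel_measurable (lebesgue_on G)" and "open G"
  obtains g N where "g \<in> borel_measurable borel" "N \<in> null_sets lborel"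
    "\<And>x. x \<in> G \<Longrightarrow> x \<notin> N \<Longrightarrow> f x = g x"
proof -
  have "G \<inter> space lebesgue \<in> sets lebesgue" using \<open>open G\<close> by auto
  \<comment> \<open>Extension by zero reduces to functions on the whole space, which have Borel
    representatives.\<close>
  then have "(\<lambda>x. f x * indicator G x) \<in> borel_measurable lebesgue"
    using f by (subst (asm) borel_measurable_restrict_space_iff) (simp_all add: mult.commute)
  then obtain g where g: "g \<in> borel_measurable lborel" "AE x in lborel. f x * indicator G x = g x"
    using completion_ex_borel_measurable_real by blast
  then obtain N where "N \<in> null_sets lborel" "{x \<in> space lborel. f x * indicator G x \<noteq> g x} \<subseteq> N"
    unfolding eventually_ae_filter by auto
  then have "f x = g x" if "x \<in> G" "x \<notin> N" for x
    using that by (auto simp: subset_iff dest!: spec[of _ x])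
  with g(1) \<open>N \<in> null_sets lborel\<close> show thesis by (intro that[of g N]) auto
qed

lemma AE_lebesgue_pair_off_null:
  fixes N :: "'a::euclidean_space set"
  assumes "N \<in> null_sets lborel"
  shows "AE (x, y) in (lebesgue :: ('a \<times> 'a) measure). x \<notin> N \<and> y \<notin> N"
proof -
  have [measurable]: "N \<in> sets borel" using assms by auto
  have "AE x in lborel. x \<notin> N" using assms by (rule AE_not_in)
  then have "AE x in lborel. AE y in lborel. x \<notin> N \<and> y \<notin> N"
    by eventually_elim (use \<open>AE x in lborel. x \<notin> N\<close> in auto)
  moreover have "{q \<in> space (lborel \<Otimes>\<^sub>M lborel :: ('a \<times> 'a) measure). fst q \<notin> N \<and> snd q \<notin> N}
      \<in> sets (lborel \<Otimes>\<^sub>M lborel)"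
    by measurable
  ultimately have "AE q in (lborel \<Otimes>\<^sub>M lborel :: ('a \<times> 'a) measure). fst q \<notin> N \<and> snd q \<notin> N"
    by (intro lborel_pair.AE_pair_measure) simp_all
  then show ?thesis
    by (intro AE_completion) (simp only: lborel_prod case_prod_unfold)
qed

text \<open>\<open>enn2real\<close> sends \<infinity> to 0, so infinite values need care. For finite
  \<open>W\<close> the two hypotheses make \<open>X\<close> and \<open>Y\<close> both finite or both
  infinite, and in the latter case the left side is 0; for infinite \<open>W\<close> the right side
  is \<infinity>.\<close>

lemma enn2real_diff_le:
  assumes "0 < c" "0 < d" "0 < C"
    and "ennreal c * X \<le> ennreal c * Y + ennreal (C * d) * W"
    and "ennreal c * Y \<le> ennreal c * X + ennreal (C * d) * W"
  shows "ennreal (c * (\<bar>enn2real X - enn2real Y\<bar> / d)) \<le> ennreal C * W"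
proof (cases "W = top")
  case False
  then obtain w where W: "W = ennreal w" "0 \<le> w" by (cases W) auto
  show ?thesis
  proof (cases X; cases Y)
    fix a b assume X: "X = ennreal a" "0 \<le> a" and Y: "Y = ennreal b" "0 \<le> b"
    have "c * a \<le> c * b + C * d * w" "c * b \<le> c * a + C * d * w"
      using assms X Y W by (simp_all flip: ennreal_mult ennreal_plus)
    then have "c * \<bar>a - b\<bar> \<le> C * w * d" by (simp add: abs_if algebra_simps)
    then have "c * (\<bar>a - b\<bar> / d) \<le> C * w" using \<open>0 < d\<close> by (simp add: field_simps)
    then show ?thesis using X Y W assms by (simp flip: ennreal_mult add: ennreal_leI)
  next
    fix a assume "X = ennreal a" "0 \<le> a" "Y = top"
    with assms W show ?thesis
      by (simp add: ennreal_mult_top top_unique flip: ennreal_mult ennreal_plus)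
  next
    fix a assume "X = top" "Y = ennreal a" "0 \<le> a"
    with assms W show ?thesis
      by (simp add: ennreal_mult_top top_unique flip: ennreal_mult ennreal_plus)
  qed simp
qed (use assms in \<open>simp add: ennreal_mult_top\<close>)

section \<open>Reduction to a Borel representative and symmetrization\<close>

theorem proposition4p4:
  shows "\<exists>C::real. C > 0 \<and>
    (\<forall>(G :: (real ^ 'n) set) (s::real) (p::real) (\<omega> :: real ^ 'n \<Rightarrow> real) (R :: real ^ 'n \<Rightarrow> real).
      G \<noteq> {} \<longrightarrow> open G \<longrightarrow> 0 \<le> s \<longrightarrow> s \<le> 2 \<longrightarrow> 1 < p \<longrightarrow>
      Ap_weight p \<omega> \<longrightarrow>
      R \<in> borel_measurable (lebesgue_on G) \<longrightarrow>
      (\<forall>x\<in>G. 0 \<le> R x \<and> ereal (R x) \<le> bdry_dist G x) \<longrightarrow>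
      (\<forall>f \<in> Lp_space p G.
        (\<lambda>q. pair_weight p \<omega> 0 q * S_0 G s f q) \<in> Lp_space p UNIV \<longrightarrow>
        (\<lambda>q. pair_weight p \<omega> 1 q * S_0 G s f q) \<in> Lp_space p UNIV \<longrightarrow>
        (AE (x, y) in lebesgue.
          ennreal (\<omega> (x - y) powr (1 / p) * S_R G s R (\<lambda>v. enn2real (M_R R f v)) (x, y))
          \<le> ennreal C *
            (\<Sum>(i, j, k, l, m) \<in> {(i, j, k, l, m). {i, j, k, l, m} \<subseteq> {0, 1} \<and> k * l = 0}.
              M_dir i j (\<lambda>q. ennreal (pair_weight p \<omega> m q) *
                M_dir k l (\<lambda>q'. ennreal (S_0 G s f q')) q) (x, y) +
              M_dir i j (\<lambda>q. ennreal (pair_weight p \<omega> m q) *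
                M_dir k l (\<lambda>q'. ennreal (S_0 G s f q')) q) (y, x)))))"
proof -
  define C where "C = (16 * (3 ^ DIM(real ^ 'n) + 1) :: real)"
  let ?I = "{(i, j, k, l, m). {i, j, k, l, m} \<subseteq> {0, 1::nat} \<and> k * l = 0}"
  have "0 < C" by (simp add: C_def add_pos_pos)
  have "finite ?I"
  proof (rule finite_subset)
    show "?I \<subseteq> {..1} \<times> {..1} \<times> {..1} \<times> {..1} \<times> {..1}"
      by (intro subsetI, elim CollectE case_prodE) (simp add: le_Suc_eq)
  qed simp
  have "AE (x, y) in lebesgue.
      ennreal (\<omega> (x - y) powr (1 / p) * S_R G s R (\<lambda>v. enn2real (M_R R f v)) (x, y))
      \<le> ennreal C * (\<Sum>(i, j, k, l, m) \<in> ?I.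
          M_dir i j (\<lambda>q. ennreal (pair_weight p \<omega> m q) * M_dir k l (\<lambda>q'. ennreal (S_0 G s f q')) q) (x, y) +
          M_dir i j (\<lambda>q. ennreal (pair_weight p \<omega> m q) * M_dir k l (\<lambda>q'. ennreal (S_0 G s f q')) q) (y, x))"
    if "open G" and s: "0 \<le> s" "s \<le> 2" and f: "f \<in> borel_measurable (lebesgue_on G)"
      and R: "\<And>x. x \<in> G \<Longrightarrow> 0 \<le> R x \<and> ereal (R x) \<le> bdry_dist G x"
    for G :: "(real ^ 'n) set" and s p :: real and \<omega> R f :: "real ^ 'n \<Rightarrow> real"
  proof -
    obtain g N where g: "g \<in> borel_measurable borel" and N: "N \<in> null_sets lborel"
      and fg: "\<And>x. x \<in> G \<Longrightarrow> x \<notin> N \<Longrightarrow> f x = g x"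
      using ex_borel_off_null[OF f \<open>open G\<close>] by blast
    have "AE z in lborel. z \<in> G \<longrightarrow> f z = g z"
      using AE_not_in[OF N] by eventually_elim (simp add: fg)
    then have M_R: "M_R R f x = M_R R g x" if "x \<in> G" "x \<notin> N" for x
      using that R fg by (intro M_R_cong_AE[where G = G]) auto
    have S: "S_0 G s f (u, v) = S_0 G s g (u, v)" if "u \<notin> N" "v \<notin> N" for u v
      using that fg by (auto simp: S_0_eq indicator_def)
    define T where "T h i j k l m = M_dir i j (\<lambda>q. ennreal (pair_weight p \<omega> m q) *
      M_dir k l (\<lambda>q'. ennreal (S_0 G s h q')) q)" for h i j k l m
    \<comment> \<open>The congruence off \<open>N\<close> is applied twice, to the outer and to the
      inner operator; the weight is the same on both sides.\<close>
    have T: "T f i j k l m (x, y) = T g i j k l m (x, y)"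
      if "{i, j, k, l} \<subseteq> {0, 1}" "x \<notin> N" "y \<notin> N" for i j k l m x y
      unfolding T_def using that
      by (intro M_dir_cong_off_null[OF N] arg_cong2[where f = "(*)"] refl) (auto simp: S)
    have "ennreal (\<omega> (x - y) powr (1 / p) * S_R G s R (\<lambda>v. enn2real (M_R R f v)) (x, y))
        \<le> ennreal C * (\<Sum>(i, j, k, l, m) \<in> ?I. T f i j k l m (x, y) + T f i j k l m (y, x))"
      if xy: "x \<notin> N" "y \<notin> N" for x y
    proof (cases "x \<in> G \<and> y \<in> G \<and> x \<noteq> y \<and> \<omega> (x - y) \<noteq> 0")
      \<comment> \<open>In each excluded case the left side vanishes. Otherwise both the weight
        factor and the denominator are positive, since \<open>powr\<close> is positive on a nonzero
        base.\<close>
      case False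
      then show ?thesis by (auto simp: S_R_def)
    next
      case True
      define W where "W = (\<Sum>(i, j, k, l, m) \<in> ?I. T f i j k l m (x, y) + T f i j k l m (y, x))"
      have sum_le_W: "T f i j k l m (x, y) + T f i j k l m (y, x) \<le> W"
        if "{i, j, k, l, m} \<subseteq> {0, 1}" "k * l = 0" for i j k l m
      proof -
        let ?t = "\<lambda>(i, j, k, l, m). T f i j k l m (x, y) + T f i j k l m (y, x)"
        have "(i, j, k, l, m) \<in> ?I" using that by (simp only: mem_Collect_eq prod.case)
        then have "?t (i, j, k, l, m) \<le> sum ?t ?I"
          by (rule member_le_sum[OF _ zero_le \<open>finite ?I\<close>])
        then show ?thesis by (simp only: W_def prod.case)
      qed
      have W: "T g i j k l m (x, y) \<le> W" "T g i j k l m (y, x) \<le> W"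
        if m: "m \<in> {0, 1}" and ijkl: "{i, j, k, l} \<subseteq> {0, 1}" and kl: "k * l = 0" for i j k l m
      proof -
        have "{i, j, k, l, m} \<subseteq> {0, 1}" using ijkl m by blast
        note W = sum_le_W[OF this kl]
        have "T f i j k l m (x, y) \<le> W" 
          by (rule order_trans[OF add_increasing2[OF zero_le order_refl] W])
        then show "T g i j k l m (x, y) \<le> W" by (simp only: T[OF ijkl xy])
        have "T f i j k l m (y, x) \<le> W" 
          by (rule order_trans[OF add_increasing[OF zero_le order_refl] W])
        then show "T g i j k l m (y, x) \<le> W" by (simp only: T[OF ijkl xy(2,1)])
      qed
      define c where "c = \<omega> (x - y) powr (1 / p)"
      define d where "d = (norm (x - y) + \<bar>R x - R y\<bar>) powr s"
      have "0 < norm (x - y) + \<bar>R x - R y\<bar>" using True by (auto intro: add_pos_nonneg)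
      then have pos: "0 < c" "0 < d" using True by (auto simp: c_def d_def)
      have "ennreal c * M_R R g x \<le> ennreal c * M_R R g y + ennreal (C * d) * W"
        using M_R_compare[OF g \<open>open G\<close> s R, of x y p \<omega> 0 W] True W[of 0]
        by (simp add: T_def pair_weight_def c_def d_def C_def)
      \<comment> \<open>With the points exchanged, the weight with m = 1 at \<open>(y, x)\<close> is
        again the power of \<open>\<omega> (x - y)\<close>, so both halves carry the same factor
        \<open>c\<close>.\<close>
      moreover have "ennreal c * M_R R g y \<le> ennreal c * M_R R g x + ennreal (C * d) * W"
        using M_R_compare[OF g \<open>open G\<close> s R, of y x p \<omega> 1 W] True not_sym[of x y] W[of 1]
        by (simp add: T_def pair_weight_def c_def d_def C_def norm_minus_commute abs_minus_commute)
      ultimately have "ennreal (c * (\<bar>enn2real (M_R R g x) - enn2real (M_R R g y)\<bar> / d)) \<le> ennreal C * W"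
        using pos \<open>0 < C\<close> by (intro enn2real_diff_le)
      then show ?thesis
        using True xy by (simp add: S_R_def M_R c_def d_def W_def)
    qed
    then show ?thesis
      using AE_lebesgue_pair_off_null[OF N] unfolding T_def by (auto elim!: eventually_mono)
  qed
  then show ?thesis
    using \<open>0 < C\<close> by (intro exI[of _ C]) (auto simp: Lp_space_def)
qed

end
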